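(* Let $m$ be a fixed positive odd integer, and for integers $n \ge 1$ let \[ F^W_{m,n}(x) = (x(x+1))^m x^{4n} - (x-1)^m \in \mathbb{Z}[x]. \] There is an integer $N = N(m)$ such that for every integer $n \ge N$ with $\gcd(n,m) = 1$, the polynomial $F^W_{m,n}(x)$ equals $x^2+1$ times a polynomial that is irreducible over $\mathbb{Q}$ (equivalently, $x^2+1$ divides $F^W_{m,n}(x)$ and $F^W_{m,n}(x)/(x^2+1)$ is irreducible in $\mathbb{Z}[x]$). *)

theory Defs
  imports "HOL-Computational_Algebra.Polynomial_Factorial"
begin

definition FW :: "nat \<Rightarrow> nat \<Rightarrow> int poly" where
  "FW m n = ([:0, 1:] * [:1, 1:]) ^ m * [:0, 1:] ^ (4 * n) - [:-1, 1:] ^ m"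

end

theory Submission
  imports Defs "Berlekamp_Zassenhaus.Factor_Bound"
begin

text \<open>
  Write \<open>N = m + 4n\<close>. A root \<open>x\<close> of \<open>FW m n\<close> satisfies \<open>x^N = y^m\<close> with \<open>y = (x - 1) / (x + 1)\<close>.
  As \<open>N\<close> and \<open>m\<close> are coprime, \<open>x = t^m\<close> and \<open>y = t^N\<close> for some \<open>t\<close>, which is then a root of the
  quadrinomial \<open>t^(N+m) + t^N - t^m + 1\<close>. Hence it suffices that this quadrinomial, divided by
  \<open>t^2 + 1\<close>, is irreducible, and that \<open>FW m n\<close> has only simple roots. The former follows by Ljunggren's
  method: a factorization \<open>(t^2 + 1) u v\<close> of the quadrinomial \<open>Q\<close> gives \<open>G = (t^2 + 1) u v*\<close> with
  \<open>G G* = Q Q*\<close> (a star denotes the reciprocal polynomial). The middle coefficient of \<open>G G*\<close> is the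
  sum of squares of the coefficients of \<open>G\<close>, so \<open>G\<close> has four coefficients \<open>1\<close> or \<open>-1\<close>, and comparing
  exponents yields that \<open>G\<close> is \<open>Q\<close> or \<open>Q*\<close> up to sign. Then \<open>u\<close> or \<open>v\<close> is self-reciprocal up to sign,
  but a common root of \<open>Q\<close> and \<open>Q*\<close> is a root of \<open>t^2 + 1\<close>, and these are simple roots of \<open>Q\<close>.
\<close>

hide_const (open) up_ring.monom up_ring.coeff module.smult

section \<open>Ljunggren's method: polynomials sharing the product \<open>G * reflect_poly G\<close>
  with the quadrinomial\<close>

lemma sum_squares_eq_2:
  fixes f :: "nat \<Rightarrow> int"
  assumes "finite S" and "(\<Sum>i\<in>S. (f i)\<^sup>2) = 2"
  obtains a b where "a \<in> S" "b \<in> S" "b < a" "\<bar>f a\<bar> = 1" "\<bar>f b\<bar> = 1"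
    "\<And>i. i \<in> S \<Longrightarrow> i \<noteq> a \<Longrightarrow> i \<noteq> b \<Longrightarrow> f i = 0"
proof -
  define T where "T = {i \<in> S. f i \<noteq> 0}"
  have fT: "finite T" using assms(1) by (simp add: T_def)
  have sT: "(\<Sum>i\<in>T. (f i)\<^sup>2) = 2"
    unfolding assms(2)[symmetric] T_def using assms(1) by (intro sum.mono_neutral_left) auto
  have ge: "(f i)\<^sup>2 \<ge> 1" if "i \<in> T" for i
    using that by (simp add: T_def int_one_le_iff_zero_less)
  have "(\<Sum>i\<in>T. (f i)\<^sup>2) \<ge> (\<Sum>i\<in>T. 1)" using ge by (intro sum_mono) auto
  then have "card T \<le> 2" using sT by simp
  moreover have "card T \<noteq> 0" using sT fT by auto
  moreover have "card T \<noteq> 1"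
  proof
    assume "card T = 1"
    then obtain x where "T = {x}" by (auto simp: card_1_singleton_iff)
    with sT have "(f x)\<^sup>2 = 2" by simp
    moreover have "\<bar>f x\<bar> = 0 \<or> \<bar>f x\<bar> = 1 \<or> 2 \<le> \<bar>f x\<bar>" by linarith
    moreover have "2 \<le> \<bar>f x\<bar> \<Longrightarrow> 4 \<le> (f x)\<^sup>2"
      using power_mono[of 2 "\<bar>f x\<bar>" 2] by simp
    moreover have "\<bar>f x\<bar>\<^sup>2 = (f x)\<^sup>2" by simp
    ultimately show False by (elim disjE) (simp_all del: power2_abs)
  qed
  ultimately have "card T = 2" by linarith
  then obtain a b where T: "T = {a, b}" "b < a"
    by (metis card_2_iff doubleton_eq_iff linorder_neq_iff)
  have "(f a)\<^sup>2 + (f b)\<^sup>2 = 2" using sT T by simp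
  then have "(f a)\<^sup>2 = 1" "(f b)\<^sup>2 = 1" using ge[of a] ge[of b] T by auto
  then show ?thesis
    using that[of a b] T unfolding T_def by (auto simp: abs_square_eq_1)
qed

definition quadrinomial :: "nat \<Rightarrow> nat \<Rightarrow> int poly" where
  "quadrinomial m N = monom 1 (N + m) + monom 1 N - monom 1 m + 1"

lemma one_eq_monom: "(1::'a::comm_semiring_1 poly) = monom 1 0"
  by (rule monom_eq_1[symmetric])

lemma coeff_quadrinomial:
  "coeff (quadrinomial m N) i = of_bool (i = N + m) + of_bool (i = N) - of_bool (i = m) + of_bool (i = 0)"
  unfolding quadrinomial_def one_eq_monom by auto

context
  fixes m N :: nat
  assumes m: "0 < m" and mN: "m < N"
begin

lemma degree_quadrinomial: "degree (quadrinomial m N) = N + m"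
proof (rule antisym)
  show "degree (quadrinomial m N) \<le> N + m"
    by (rule degree_le) (use m mN in \<open>auto simp: coeff_quadrinomial\<close>)
  show "N + m \<le> degree (quadrinomial m N)"
    by (rule le_degree) (use m mN in \<open>auto simp: coeff_quadrinomial\<close>)
qed

lemma lead_coeff_quadrinomial: "lead_coeff (quadrinomial m N) = 1"
  using m mN by (simp add: degree_quadrinomial coeff_quadrinomial)

lemma coeff_0_quadrinomial: "coeff (quadrinomial m N) 0 = 1"
  using m mN by (simp add: coeff_quadrinomial)

lemma reflect_quadrinomial:
  "reflect_poly (quadrinomial m N) = monom 1 (N + m) - monom 1 N + monom 1 m + 1"
  by (rule poly_eqI, use m mN in \<open>auto simp: coeff_reflect_poly degree_quadrinomial coeff_quadrinomial of_bool_def\<close>)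

text \<open>With A = t^(N+m) + 1 and B = t^N - t^m the two factors are A + B and A - B, so the
  product is A^2 - B^2; each square contributes 2 to the middle coefficient.\<close>

lemma quadrinomial_times_reflect:
  "quadrinomial m N * reflect_poly (quadrinomial m N) =
     monom 1 (2 * (N + m)) - monom 1 (2 * N) + monom 4 (N + m) - monom 1 (2 * m) + 1"
proof -
  have "monom 4 (N + m) = monom 1 (N + m) + monom 1 (N + m) + monom 1 (N + m) + monom (1::int) (N + m)"
    by (simp add: add_monom)
  then show ?thesis unfolding reflect_quadrinomial unfolding quadrinomial_def
    by (simp add: algebra_simps mult_monom flip: mult_2)
qed

text \<open>The equation \<open>GG\<close> cannot tell \<open>G\<close> from \<open>-G\<close>; the
  sign of the constant coefficient selects one of them.\<close>

lemma norm_eq_quadrinomial: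
  fixes G :: "int poly"
  assumes GG: "G * reflect_poly G = quadrinomial m N * reflect_poly (quadrinomial m N)"
    and lc: "coeff G 0 > 0"
  shows "G = quadrinomial m N \<or> G = reflect_poly (quadrinomial m N)"
proof -
  define d where "d = N + m"
  have G0: "coeff G 0 \<noteq> 0" using lc by simp
  then have Gnz: "G \<noteq> 0" by auto
  have "degree G + degree G = d + d"
    using arg_cong[OF GG, of degree] Gnz G0 coeff_0_quadrinomial degree_quadrinomial
    by (subst (asm) degree_mult_eq; (subst (asm) degree_mult_eq)?) (auto simp: d_def)
  then have dG: "degree G = d" by simp
  have "coeff G 0 * coeff G d = 1"
    using arg_cong[OF GG, of "\<lambda>p. coeff p 0"] coeff_0_quadrinomial lead_coeff_quadrinomial dG
    by (simp add: coeff_mult_0)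
  then have c: "coeff G 0 = 1" "coeff G d = 1"
    using lc by (auto simp: zmult_eq_1_iff)
  have d: "d > 0" using m by (simp add: d_def)
  have "(\<Sum>i\<le>d. (coeff G i)\<^sup>2) = coeff (G * reflect_poly G) d"
    unfolding coeff_mult by (intro sum.cong) (auto simp: coeff_reflect_poly dG power2_eq_square)
  also have "\<dots> = 4"
    unfolding GG quadrinomial_times_reflect one_eq_monom using m mN by (auto simp: d_def)
  \<comment> \<open>The two end coefficients use up 2 of the total 4, so the interior squares sum to
    2.\<close>
  also have "{..d} = insert 0 (insert d {0<..<d})" using d by auto
  finally have "(\<Sum>i\<in>{0<..<d}. (coeff G i)\<^sup>2) = 2" using d c by simp
  then obtain a b where ab: "a \<in> {0<..<d}" "b \<in> {0<..<d}" "b < a"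
     and abs: "\<bar>coeff G a\<bar> = 1" "\<bar>coeff G b\<bar> = 1"
     and z: "\<And>i. i \<in> {0<..<d} \<Longrightarrow> i \<noteq> a \<Longrightarrow> i \<noteq> b \<Longrightarrow> coeff G i = 0"
    by (rule sum_squares_eq_2[rotated]) auto
  define e f where "e = coeff G a" and "f = coeff G b"
  have ef: "e = 1 \<or> e = -1" "f = 1 \<or> f = -1" using abs unfolding e_def f_def by linarith+
  have cG: "coeff G i = coeff (monom 1 d + monom e a + monom f b + monom 1 0) i" for i
    using ab z[of i] c dG unfolding e_def f_def by (cases "i > d") (auto simp: coeff_eq_0)
  then have G: "G = monom 1 d + monom e a + monom f b + monom 1 0" by (rule poly_eqI)
  have G': "reflect_poly G = monom 1 d + monom e (d - a) + monom f (d - b) + monom 1 0"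
  proof (rule poly_eqI)
    fix i
    show "coeff (reflect_poly G) i = coeff (monom 1 d + monom e (d - a) + monom f (d - b) + monom 1 0) i"
    proof (cases "i \<le> d")
      case True
      then have "d = d - i \<longleftrightarrow> i = 0" "a = d - i \<longleftrightarrow> i = d - a" "b = d - i \<longleftrightarrow> i = d - b" "0 = d - i \<longleftrightarrow> i = d"
        using ab d by auto
      then show ?thesis
        using True by (simp only: coeff_reflect_poly dG cG coeff_add coeff_monom) (auto simp: algebra_simps)
    next
      case False
      then show ?thesis using ab by (auto simp: coeff_reflect_poly dG)
    qed
  qed
  \<comment> \<open>Compares the coefficients of t^(d+k) in \<open>GG\<close>; both sides are
    self-reciprocal, so the upper half carries all the information. The last term comes from 2N = d
    + (N - m).\<close>
  have key: "e * of_bool (k = d - a) + f * of_bool (k = d - b)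
      + e * of_bool (k = a) + f * of_bool (k = b) + e * f * of_bool (k = a - b) + of_bool (k = N - m) = 0" if "k > 0" for k
  proof -
    \<comment> \<open>The sixteen exponent sums of the product: those that cannot exceed
      \<open>d\<close> drop out, with \<open>b < a\<close> deciding the mixed ones.\<close>
    have eqs: "d + d = d + k \<longleftrightarrow> k = d" "d + (d - a) = d + k \<longleftrightarrow> k = d - a" "d + (d - b) = d + k \<longleftrightarrow> k = d - b"
      "d + 0 = d + k \<longleftrightarrow> False" "a + d = d + k \<longleftrightarrow> k = a" "a + (d - a) = d + k \<longleftrightarrow> False"
      "a + (d - b) = d + k \<longleftrightarrow> k = a - b" "a + 0 = d + k \<longleftrightarrow> False" "b + d = d + k \<longleftrightarrow> k = b"
      "b + (d - a) = d + k \<longleftrightarrow> False" "b + (d - b) = d + k \<longleftrightarrow> False" "b + 0 = d + k \<longleftrightarrow> False"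
      "0 + d = d + k \<longleftrightarrow> False" "0 + (d - a) = d + k \<longleftrightarrow> False" "0 + (d - b) = d + k \<longleftrightarrow> False"
      "0 + 0 = d + k \<longleftrightarrow> False"
      using ab that by auto
    have "coeff (G * reflect_poly G) (d + k) = of_bool (k = d) + e * of_bool (k = d - a) + f * of_bool (k = d - b)
      + e * of_bool (k = a) + f * of_bool (k = b) + e * f * of_bool (k = a - b)"
      unfolding G' unfolding G
      by (simp only: distrib_left distrib_right mult_monom coeff_add coeff_monom eqs if_False)
        (simp add: of_bool_def)
    moreover have "coeff (G * reflect_poly G) (d + k) = of_bool (k = d) - of_bool (k = N - m)"
      unfolding GG quadrinomial_times_reflect one_eq_monom using m mN that
      by (auto simp: d_def)
    ultimately show ?thesis by simp
  qed
  have S: "(\<Sum>k\<in>{1..d}. g k * of_bool (k = c)) = g c" if "c \<in> {1..d}" for c and g :: "nat \<Rightarrow> int"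
    using that by (simp add: of_bool_def if_distrib sum.delta cong: if_cong)
  have in_d: "d - a \<in> {1..d}" "d - b \<in> {1..d}" "a \<in> {1..d}" "b \<in> {1..d}" "a - b \<in> {1..d}" "N - m \<in> {1..d}"
    using ab mN by (auto simp: d_def)
  \<comment> \<open>Weighting \<open>key\<close> by \<open>g = 1\<close> gives \<open>f = -e\<close>, and by \<open>g k = k\<close> it gives \<open>a - b = N - m\<close>.\<close>
  have sumkey: "e * g (d - a) + f * g (d - b) + e * g a + f * g b + e * f * g (a - b) + g (N - m) = 0"
    for g :: "nat \<Rightarrow> int"
  proof -
    have "0 = (\<Sum>k\<in>{1..d}. g k * (e * of_bool (k = d - a) + f * of_bool (k = d - b)
      + e * of_bool (k = a) + f * of_bool (k = b) + e * f * of_bool (k = a - b) + of_bool (k = N - m)))"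
      using key by (intro sum.neutral[symmetric]) auto
    also have "\<dots> = e * (\<Sum>k\<in>{1..d}. g k * of_bool (k = d - a)) + f * (\<Sum>k\<in>{1..d}. g k * of_bool (k = d - b))
       + e * (\<Sum>k\<in>{1..d}. g k * of_bool (k = a)) + f * (\<Sum>k\<in>{1..d}. g k * of_bool (k = b))
       + e * f * (\<Sum>k\<in>{1..d}. g k * of_bool (k = a - b)) + (\<Sum>k\<in>{1..d}. g k * of_bool (k = N - m))"
      unfolding sum_distrib_left sum.distrib[symmetric] by (intro sum.cong) (auto simp: algebra_simps)
    finally show ?thesis using in_d by (simp add: S)
  qed
  have fe: "f = - e" using sumkey[of "\<lambda>_. 1"] ef by auto
  have ee: "e * e = 1" using ef by auto
  have "int (a - b) = int (N - m)"
    using sumkey[of int] ab mN ee unfolding fe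
    by (simp add: algebra_simps of_nat_diff less_imp_le flip: distrib_left)
  then have amb: "a - b = N - m" by simp
  \<comment> \<open>Now the last two terms of \<open>key\<close> cancel, and at \<open>k = a\<close>
    the summand \<open>e\<close> can only be balanced by the term at \<open>d - b\<close>.\<close>
  have "a + b = d"
    using key[of a] ab ef unfolding fe amb
    by (auto simp: of_bool_def split: if_splits)
  then have "a = N" "b = m" using amb ab mN unfolding d_def by auto
  \<comment> \<open>\<open>e = 1\<close> gives the quadrinomial, \<open>e = -1\<close> its
    reciprocal.\<close>
  then show ?thesis
    using ef(1) unfolding reflect_quadrinomial unfolding quadrinomial_def G fe d_def one_eq_monom
    by (auto simp: minus_monom)
qed
end

lemma norm_eq_quadrinomial_up_to_sign:
  fixes G :: "int poly"
  assumes mN: "0 < m" "m < N"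
    and GG: "G * reflect_poly G = quadrinomial m N * reflect_poly (quadrinomial m N)"
    and G0: "coeff G 0 \<noteq> 0"
  obtains c :: int where "c = 1 \<or> c = -1"
    "G = smult c (quadrinomial m N) \<or> G = smult c (reflect_poly (quadrinomial m N))"
proof (cases "coeff G 0 > 0")
  case True
  then show ?thesis
    using norm_eq_quadrinomial[OF mN GG] that[of 1] by simp
next
  case False
  have "smult (-1) G * reflect_poly (smult (-1) G) = quadrinomial m N * reflect_poly (quadrinomial m N)"
    unfolding reflect_poly_smult using GG by simp
  moreover have "coeff (smult (-1) G) 0 > 0" using False G0 by simp
  ultimately have "smult (-1) G = quadrinomial m N \<or> smult (-1) G = reflect_poly (quadrinomial m N)"
    using norm_eq_quadrinomial[OF mN, of "smult (-1) G"] by simp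
  then have "smult (-1) (smult (-1) G) = smult (-1) (quadrinomial m N) \<or> smult (-1) (smult (-1) G) = smult (-1) (reflect_poly (quadrinomial m N))"
    by (elim disjE) (simp_all only: simp_thms)
  then show ?thesis using that[of "-1"] by simp
qed

section \<open>Complex evaluation and elementary facts on powers\<close>

lemma diff_dvd_power_diff: "x - y dvd x ^ n - (y :: 'a :: comm_ring_1) ^ n"
  by (simp add: power_diff_sumr2)

abbreviation ceval :: "int poly \<Rightarrow> complex \<Rightarrow> complex" where
  "ceval p \<equiv> poly (of_int_poly p)"

lemma ceval_quadrinomial: "ceval (quadrinomial m N) z = z ^ (N + m) + z ^ N - z ^ m + 1"
  by (simp add: quadrinomial_def of_int_poly_hom.hom_add of_int_poly_hom.hom_minus poly_monom)

lemma ceval_root_exists: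
  assumes "degree p > 0"
  obtains z where "ceval p z = 0"
proof -
  have "\<not> constant (poly (of_int_poly p :: complex poly))"
    using assms by (simp add: constant_degree)
  then show ?thesis using fundamental_theorem_of_algebra that by blast
qed

lemma power_eq_1_gcd:
  fixes w :: "'a :: field"
  assumes "gcd m n = 1" "w ^ m = 1" "w ^ n = 1"
  shows "w = 1"
proof (cases "m = 0")
  case True
  then show ?thesis using assms by simp
next
  case False
  then obtain x y where "m * x = n * y + 1"
    using bezout_nat[of m n] assms(1) by auto
  then have "w ^ (m * x) = w ^ (n * y) * w" by simp
  then show ?thesis using assms by (simp add: power_mult)
qed

section \<open>Values of the quadrinomial where z^2 = -1, and its common roots with its
  reciprocal\<close>

context
  fixes m n :: nat
  assumes odd_m: "odd m" and n: "0 < n" and cop: "gcd n m = 1"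
begin

private lemma m: "0 < m" using odd_m by (cases m) auto

private lemma mN: "m < m + 4 * n" using n by simp

definition quad where "quad = quadrinomial m (m + 4 * n)"

lemma i_power:
  assumes "z\<^sup>2 = (-1 :: complex)"
  shows "z ^ (4 * k) = 1" "z ^ (2 * m) = -1"
proof -
  show "z ^ (4 * k) = 1"
    using assms power_mult[of z 2 "2 * k"] by (simp add: power_mult)
  show "z ^ (2 * m) = -1" using assms odd_m by (simp add: power_mult)
qed

text \<open>With N = m + 4n, here z^N = z^m and z^(N+m) = -1, so z Q'(z) = 4n z^m - (2m + 4n), which
  |z^m| = 1 keeps from vanishing.\<close>

lemma ceval_quad_i:
  assumes "z\<^sup>2 = -1"
  shows "ceval quad z = 0" "ceval (pderiv quad) z \<noteq> 0"
proof -
  note p = i_power[OF assms]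
  have 1: "z ^ (m + 4 * n) = z ^ m" using p(1) by (simp add: power_add)
  have 2: "z ^ (m + 4 * n + m) = -1"
    using p(2) unfolding power_add[of z "m + 4 * n" m] 1 by (simp add: mult_2 power_add)
  show "ceval quad z = 0"
    unfolding quad_def ceval_quadrinomial using 1 2 by simp
  \<comment> \<open>Multiplying by \<open>z\<close> restores the exponents lowered by
    differentiation, so the evaluations \<open>1\<close> and \<open>2\<close> apply.\<close>
  have "z * ceval (pderiv quad) z = of_nat (m + 4 * n + m) * z ^ (m + 4 * n + m)
      + of_nat (m + 4 * n) * z ^ (m + 4 * n) - of_nat m * z ^ m"
  proof -
    have *: "z * (c * z ^ (k - Suc 0)) = c * z ^ k" if "0 < k" for c k
      using that by (cases k) auto
    show ?thesis
      unfolding quad_def quadrinomial_def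
      by (simp add: pderiv_add pderiv_diff pderiv_monom of_int_poly_hom.hom_add of_int_poly_hom.hom_minus poly_monom
        distrib_left right_diff_distrib * m del: of_nat_add of_nat_mult)
  qed
  also have "\<dots> = of_nat (4 * n) * z ^ m - of_nat (2 * m + 4 * n)"
    unfolding 1 2 by (simp add: algebra_simps)
  also have "\<dots> \<noteq> 0"
  proof
    assume "of_nat (4 * n) * z ^ m - of_nat (2 * m + 4 * n) = 0"
    then have "cmod (of_nat (4 * n) * z ^ m) = cmod (of_nat (2 * m + 4 * n))" by simp
    moreover have "cmod (z ^ m) = 1"
    proof -
      have "(cmod (z ^ m))\<^sup>2 = 1"
        using p(2) by (metis norm_minus_cancel norm_one norm_power power_even_eq)
      then show ?thesis using power2_eq_1_iff[of "cmod (z ^ m)"] norm_ge_zero[of "z ^ m"] by linarith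
    qed
    ultimately have "real (4 * n) = real (2 * m + 4 * n)"
      unfolding norm_mult norm_of_nat by simp
    then show False using m by simp
  qed
  finally show "ceval (pderiv quad) z \<noteq> 0" by auto
qed

text \<open>Subtracting the equations gives z^(4n) = 1; the first one then gives z^(2m) = -1, hence
  z^(4m) = 1. Coprimality yields z^4 = 1, and as \<open>m\<close> is odd, z^(2m) = z^2.\<close>

lemma common_root:
  assumes "ceval quad z = 0" "ceval (reflect_poly quad) z = 0"
  shows "z\<^sup>2 = -1"
proof -
  have a: "z ^ (m + 4 * n + m) + z ^ (m + 4 * n) - z ^ m + 1 = 0"
    using assms(1) unfolding quad_def ceval_quadrinomial .
  have b: "z ^ (m + 4 * n + m) - z ^ (m + 4 * n) + z ^ m + 1 = 0"
    using assms(2) unfolding quad_def reflect_quadrinomial[OF m mN]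
    by (simp add: of_int_poly_hom.hom_add of_int_poly_hom.hom_minus poly_monom)
  have nz: "z \<noteq> 0" using a m by (auto simp: power_0_left)
  have "2 * (z ^ (m + 4 * n) - z ^ m) =
      (z ^ (m + 4 * n + m) + z ^ (m + 4 * n) - z ^ m + 1) - (z ^ (m + 4 * n + m) - z ^ (m + 4 * n) + z ^ m + 1)"
    by simp
  then have c: "z ^ (m + 4 * n) = z ^ m" unfolding a b by simp
  then have n1: "(z ^ 4) ^ n = 1" using nz by (simp add: power_add power_mult)
  have "z ^ (m + 4 * n + m) = z ^ m * z ^ m" unfolding power_add[of z "m + 4 * n" m] c ..
  then have d: "z ^ m * z ^ m = -1" using a c by (simp add: eq_neg_iff_add_eq_0)
  have "4 * m = (m + m) + (m + m)" by simp
  then have m1: "(z ^ 4) ^ m = 1" by (simp only: power_mult[symmetric] power_add d) simp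
  have 4: "z ^ 4 = 1" by (rule power_eq_1_gcd[OF cop n1 m1])
  obtain j where j: "m = Suc (2 * j)" using odd_m by (auto elim: oddE)
  have "z ^ m * z ^ m = (z ^ 4) ^ j * z\<^sup>2"
    by (simp add: j power_mult[symmetric] power2_eq_square flip: power_add mult_2)
  then show ?thesis using d 4 by simp
qed

section \<open>Irreducibility of the quadrinomial divided by t^2 + 1\<close>

definition quad_cofactor where "quad_cofactor = (SOME q. quad = [:1, 0, 1:] * q)"

lemma X2_plus_1: "[:1, 0, 1:] = monom 1 2 + (1 :: int poly)"
  by (rule poly_eqI) (auto simp: coeff_pCons numeral_2_eq_2 split: nat.splits)

lemma ceval_X2_plus_1: "ceval [:1, 0, 1:] z = z\<^sup>2 + 1"
  by (simp add: power2_eq_square)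

lemma quad_eq: "quad = [:1, 0, 1:] * quad_cofactor"
proof -
  have "monom 1 2 + (1 :: int poly) dvd monom 1 4 - 1"
    by (rule dvdI[of _ _ "monom 1 2 - 1"]) (simp add: algebra_simps mult_monom)
  also have "monom 1 4 - 1 dvd monom 1 4 ^ n - (1 :: int poly) ^ n" by (rule diff_dvd_power_diff)
  finally have 1: "monom 1 2 + (1 :: int poly) dvd monom 1 (4 * n) - 1"
    by (simp add: monom_power mult.commute)
  have "monom 1 2 - (- 1 :: int poly) dvd monom 1 2 ^ (2 * n + m) - (- 1) ^ (2 * n + m)"
    by (rule diff_dvd_power_diff)
  then have 2: "monom 1 2 + (1 :: int poly) dvd monom 1 (2 * (2 * n + m)) + 1"
    using odd_m by (simp add: monom_power mult.commute)
  \<comment> \<open>Both summands are divisible by t^2 + 1: the first through t^4 - 1, the second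
    because 2n + m is odd.\<close>
  have "quad = monom 1 m * (monom 1 (4 * n) - 1) + (monom 1 (2 * (2 * n + m)) + 1)"
    unfolding quad_def quadrinomial_def by (simp add: algebra_simps mult_monom)
  then have "[:1, 0, 1:] dvd quad"
    unfolding X2_plus_1 using 1 2 by (simp add: dvd_add)
  then show ?thesis unfolding quad_cofactor_def dvd_def by (rule someI_ex)
qed

lemma ceval_quad: "ceval quad z = (z\<^sup>2 + 1) * ceval quad_cofactor z"
  by (simp only: quad_eq of_int_poly_hom.hom_mult poly_mult ceval_X2_plus_1)

lemma ceval_quad_cofactor_i: "z\<^sup>2 = -1 \<Longrightarrow> ceval quad_cofactor z \<noteq> 0"
proof
  assume z: "z\<^sup>2 = -1" and 0: "ceval quad_cofactor z = 0"
  have "ceval (pderiv quad) z = (z\<^sup>2 + 1) * ceval (pderiv quad_cofactor) z + ceval quad_cofactor z * ceval (pderiv [:1, 0, 1:]) z"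
    by (simp only: quad_eq pderiv_mult of_int_poly_hom.hom_mult of_int_poly_hom.hom_add poly_mult poly_add
      ceval_X2_plus_1)
  then have "ceval (pderiv quad) z = 0" using z 0 by simp
  then show False using ceval_quad_i(2)[OF z] by simp
qed

text \<open>A root of \<open>w\<close> is also one of \<open>reflect_poly w\<close>, hence common to
  \<open>quad\<close> and its reciprocal, so its square is -1; but there
  \<open>quad_cofactor\<close> does not vanish.\<close>

lemma no_self_reciprocal_factor:
  assumes "w dvd quad_cofactor" "degree w > 0" "w dvd reflect_poly w"
  shows False
proof -
  obtain z where z: "ceval w z = 0" using ceval_root_exists[OF assms(2)] .
  have wQ: "w dvd quad" using assms(1) unfolding quad_eq by (rule dvd_mult)
  then obtain r where r: "quad = w * r" by (elim dvdE)
  obtain s where s: "reflect_poly w = w * s" using assms(3) by (elim dvdE)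
  obtain t where t: "quad_cofactor = w * t" using assms(1) by (elim dvdE)
  have "ceval quad z = 0" using z by (simp add: r of_int_poly_hom.hom_mult)
  moreover have "ceval (reflect_poly quad) z = 0"
    using z by (simp add: r reflect_poly_mult s of_int_poly_hom.hom_mult)
  ultimately have "z\<^sup>2 = -1" by (rule common_root)
  then show False using ceval_quad_cofactor_i[of z] z by (simp add: t of_int_poly_hom.hom_mult)
qed

lemma degree_quad: "degree quad = 4 * n + 2 * m"
  unfolding quad_def degree_quadrinomial[OF m mN] by simp

lemma coeff_0_quad: "coeff quad 0 = 1"
  unfolding quad_def by (rule coeff_0_quadrinomial[OF m mN])

lemma quad_nonzero: "quad \<noteq> 0" using coeff_0_quad by auto

lemma degree_quad_cofactor: "degree quad_cofactor = 4 * n + 2 * m - 2"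
proof -
  have "quad_cofactor \<noteq> 0" using quad_nonzero quad_eq by auto
  then have "degree quad = 2 + degree quad_cofactor"
    unfolding quad_eq by (subst degree_mult_eq) auto
  then show ?thesis by (simp add: degree_quad)
qed

lemma coeff_0_quad_cofactor: "coeff quad_cofactor 0 = 1"
  using coeff_0_quad unfolding quad_eq by (simp add: coeff_mult_0)

lemma quad_cofactor_factors:
  assumes uv: "quad_cofactor = u * v"
  shows "degree u = 0 \<or> degree v = 0"
proof (rule ccontr)
  assume "\<not> ?thesis"
  then have du: "degree u > 0" and dv: "degree v > 0" by auto
  \<comment> \<open>Nonzero constant coefficients make \<open>reflect_poly\<close> an involution on
    \<open>u\<close> and \<open>v\<close>.\<close>
  have c: "coeff u 0 \<noteq> 0" "coeff v 0 \<noteq> 0"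
    using coeff_0_quad_cofactor unfolding uv by (auto simp: coeff_mult_0)
  \<comment> \<open>Reversing only \<open>v\<close> preserves \<open>G * reflect_poly G\<close>, as
    t^2 + 1 is self-reciprocal.\<close>
  define G where "G = [:1, 0, 1:] * u * reflect_poly v"
  have r: "reflect_poly [:1, 0, 1 :: int:] = [:1, 0, 1:]"
    by (simp add: reflect_poly_def)
  have rG: "reflect_poly G = [:1, 0, 1:] * reflect_poly u * v"
    unfolding G_def reflect_poly_mult r using c by simp
  have rQ: "reflect_poly quad = [:1, 0, 1:] * reflect_poly u * reflect_poly v"
    unfolding quad_eq uv reflect_poly_mult r by (simp only: mult.assoc)
  have GG: "G * reflect_poly G = quad * reflect_poly quad"
    unfolding rG rQ unfolding G_def quad_eq uv by (simp only: mult_ac)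
  have "v \<noteq> 0" using dv by auto
  then have "coeff G 0 \<noteq> 0" using c unfolding G_def by (simp add: coeff_mult_0)
  then obtain e :: int where e: "e = 1 \<or> e = -1" and GQ: "G = smult e quad \<or> G = smult e (reflect_poly quad)"
    using norm_eq_quadrinomial_up_to_sign[OF m mN GG[unfolded quad_def]] unfolding quad_def by metis
  from GQ show False
  proof
    assume "G = smult e quad"
    \<comment> \<open>Cancelling (t^2 + 1) u makes \<open>v\<close> self-reciprocal up to the sign
      \<open>e\<close>; in the other case the same happens to \<open>u\<close>.\<close>
    then have "[:1, 0, 1:] * u * reflect_poly v = [:1, 0, 1:] * u * smult e v"
      unfolding G_def quad_eq uv by (simp only: mult_smult_right mult.assoc)
    moreover have "[:1, 0, 1:] * u \<noteq> 0" using du by (auto simp only: mult_eq_0_iff) auto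
    ultimately have "reflect_poly v = smult e v" by (auto simp only: mult_cancel_left)
    then have "v dvd reflect_poly v" by (simp add: dvd_smult)
    then show False using no_self_reciprocal_factor[of v] dv uv by simp
  next
    assume "G = smult e (reflect_poly quad)"
    then have "([:1, 0, 1:] * reflect_poly v) * u = ([:1, 0, 1:] * reflect_poly v) * smult e (reflect_poly u)"
      unfolding G_def rQ by (simp only: mult_smult_right mult_smult_left mult_ac)
    moreover have "[:1, 0, 1:] * reflect_poly v \<noteq> 0" using \<open>v \<noteq> 0\<close> by (auto simp only: mult_eq_0_iff) auto
    ultimately have "u = smult e (reflect_poly u)" by (auto simp only: mult_cancel_left)
    then have "reflect_poly u = smult e u"
      using e by (metis smult_smult mult_1 mult_minus1_right minus_minus mult_minus_left smult_1_left)
    then have "u dvd reflect_poly u" by (simp add: dvd_smult)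
    then show False using no_self_reciprocal_factor[of u] du uv by simp
  qed
qed

text \<open>Constant coefficient 1 makes every constant factor a unit, so
  \<open>quad_cofactor_factors\<close> amounts to irreducibility over the integers. Primality is
  what later splits a product in \<open>FW_cofactor_factors\<close>.\<close>

lemma prime_quad_cofactor: "prime_elem quad_cofactor"
proof (rule irreducible_imp_prime_poly, rule irreducibleI)
  show "quad_cofactor \<noteq> 0" using coeff_0_quad_cofactor by auto
  have "degree quad_cofactor > 0" using degree_quad_cofactor m n by simp
  then show "\<not> quad_cofactor dvd 1" by (auto dest: dvd_imp_degree_le)
next
  fix a b assume ab: "quad_cofactor = a * b"
  then have c: "coeff a 0 * coeff b 0 = 1" using coeff_0_quad_cofactor by (simp add: coeff_mult_0)
  have "p dvd 1" if "degree p = 0" "coeff p 0 dvd 1" for p :: "int poly"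
    using that by (auto elim!: degree_eq_zeroE simp: is_unit_const_poly_iff)
  moreover have "coeff a 0 dvd 1" "coeff b 0 dvd 1"
    using c by (metis dvdI, metis dvdI mult.commute)
  ultimately show "a dvd 1 \<or> b dvd 1" using quad_cofactor_factors[OF ab] by blast
qed


section \<open>Divisibility of \<open>FW m n\<close> by x^2 + 1 and parametrization of its
  roots\<close>

lemma FW_altdef:
  "FW m n = ([:0, 1:] * ([:0, 1:] + 1)) ^ m * ([:0, 1:] ^ 4) ^ n - ([:0, 1:] - 1) ^ m"
proof -
  have "[:1, 1:] = [:0, 1:] + (1 :: int poly)" "[:-1, 1:] = [:0, 1:] - (1 :: int poly)"
    by (rule poly_eqI, auto simp: coeff_pCons split: nat.splits)+
  then show ?thesis by (simp only: FW_def power_mult)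
qed

text \<open>The choice is legitimate by \<open>FW_eq\<close>, and unique because integer polynomials
  form a domain.\<close>

definition FW_cofactor where "FW_cofactor = (SOME q. FW m n = [:1, 0, 1:] * q)"

lemma FW_eq: "FW m n = [:1, 0, 1:] * FW_cofactor"
proof -
  define x :: "int poly" where "x = [:0, 1:]"
  have x2: "[:1, 0, 1:] = x\<^sup>2 + 1"
    by (rule poly_eqI) (auto simp: x_def power2_eq_square coeff_pCons split: nat.splits)
  have "x\<^sup>2 + 1 dvd x ^ 4 - 1"
    by (rule dvdI[of _ _ "x\<^sup>2 - 1"]) (simp add: algebra_simps flip: power_add)
  also have "x ^ 4 - 1 dvd (x ^ 4) ^ n - 1 ^ n" by (rule diff_dvd_power_diff)
  finally have 1: "x\<^sup>2 + 1 dvd (x ^ 4) ^ n - 1" by simp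
  \<comment> \<open>The difference of the two bases is exactly x^2 + 1.\<close>
  have "x * (x + 1) - (x - 1) dvd (x * (x + 1)) ^ m - (x - 1) ^ m" by (rule diff_dvd_power_diff)
  then have 2: "x\<^sup>2 + 1 dvd (x * (x + 1)) ^ m - (x - 1) ^ m"
    by (simp add: algebra_simps power2_eq_square)
  have "FW m n = (x * (x + 1)) ^ m * ((x ^ 4) ^ n - 1) + ((x * (x + 1)) ^ m - (x - 1) ^ m)"
    unfolding FW_altdef x_def[symmetric] by (simp add: right_diff_distrib)
  then have "[:1, 0, 1:] dvd FW m n"
    unfolding x2 using 1 2 by simp
  then show ?thesis unfolding FW_cofactor_def dvd_def by (rule someI_ex)
qed

lemma ceval_FW: "ceval (FW m n) z = (z * (z + 1)) ^ m * z ^ (4 * n) - (z - 1) ^ m"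
  by (simp add: FW_def of_int_poly_hom.hom_mult of_int_poly_hom.hom_minus of_int_poly_hom.hom_power algebra_simps)

lemma FW_root_param:
  assumes "ceval (FW m n) z = 0"
  obtains t where "t ^ m = z" "ceval quad t = 0"
proof -
  have eq: "(z * (z + 1)) ^ m * z ^ (4 * n) = (z - 1) ^ m" using assms by (simp add: ceval_FW)
  have z: "z \<noteq> 0" "z + 1 \<noteq> 0" "z - 1 \<noteq> 0"
  proof -
    show "z \<noteq> 0" using eq m by (auto simp: power_0_left)
    show "z + 1 \<noteq> 0"
    proof
      assume "z + 1 = 0"
      with eq m have "(z - 1) ^ m = 0" by (simp add: power_0_left)
      then have "z - 1 = 0" by simp
      with \<open>z + 1 = 0\<close> have "(z + 1) - (z - 1) = 0" by simp
      then show False by simp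
    qed
    show "z - 1 \<noteq> 0" using eq m by (auto simp: power_0_left)
  qed
  define y where "y = (z - 1) / (z + 1)"
  define N where "N = m + 4 * n"
  have y: "y \<noteq> 0" using z by (simp add: y_def)
  have yz: "y ^ m = z ^ N"
  proof -
    have "(z - 1) ^ m = z ^ N * (z + 1) ^ m"
      unfolding eq[symmetric] N_def by (simp only: power_mult_distrib power_add mult_ac)
    then show ?thesis using z by (simp add: y_def power_divide)
  qed
  have "gcd m N = gcd m (2 ^ 2 * n)" by (simp add: N_def)
  also have "gcd m (2 ^ 2 * n) = gcd m n"
  proof (rule gcd_mult_right_left_cancel)
    show "algebraic_semidom_class.coprime m (2 ^ 2)"
    unfolding coprime_power_right_iff using odd_m by simp
  qed
  also have "gcd m n = 1" using cop by (simp add: gcd.commute)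
  finally have "gcd m N = 1" .
  then obtain p q where pq: "m * p = N * q + 1"
    using bezout_nat[of m N] m by auto
  \<comment> \<open>Since m p - N q = 1 and y^m = z^N, this choice gives t^m = z^(m p - N q) = z and
    t^N = y^(m p - N q) = y.\<close>
  define t where "t = z ^ p / y ^ q"
  have "t ^ m = z ^ (m * p) / (y ^ m) ^ q"
    by (simp add: t_def power_divide mult.commute flip: power_mult)
  also have "\<dots> = z"
    unfolding yz pq using z by (simp add: power_mult)
  finally have tm: "t ^ m = z" .
  have "t ^ N = (z ^ N) ^ p / y ^ (N * q)"
    by (simp add: t_def power_divide mult.commute flip: power_mult)
  also have "\<dots> = y ^ (m * p) / y ^ (N * q)"
    unfolding yz[symmetric] by (simp add: power_mult)
  also have "\<dots> = y"
    unfolding pq using y by simp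
  finally have tN: "t ^ N = y" .
  have "ceval quad t = y * (z + 1) - z + 1"
    unfolding quad_def ceval_quadrinomial N_def[symmetric]
    by (simp add: power_add tm tN algebra_simps)
  also have "\<dots> = 0" using z by (simp add: y_def)
  finally show ?thesis using that tm by blast
qed

section \<open>Simplicity of the roots of \<open>FW m n\<close>\<close>

lemma FW_no_real_root: "ceval (FW m n) (of_real x) \<noteq> 0"
proof
  assume "ceval (FW m n) (of_real x) = 0"
  then have "complex_of_real ((x * (x + 1)) ^ m * x ^ (4 * n)) = of_real ((x - 1) ^ m)"
    by (simp add: ceval_FW)
  then have eq: "(x * (x + 1)) ^ m * x ^ (4 * n) = (x - 1) ^ m"
    by (simp only: of_real_eq_iff)
  consider "x = 0" | "x > 0" | "x < 0" by linarith
  then show False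
  proof cases
    case 1
    with eq m show False by (simp add: power_0_left)
  next
    case 2
    \<comment> \<open>A positive left side forces x > 1 as \<open>m\<close> is odd; but then it is
      at least (x + 1)^m, too large.\<close>
    then have "(x - 1) ^ m > 0" unfolding eq[symmetric] by simp
    then have x: "x > 1" using odd_m m by (simp add: zero_less_power_eq)
    have "(x - 1) ^ m < (x + 1) ^ m" using x m by (intro power_strict_mono) auto
    also have "\<dots> \<le> (x * (x + 1)) ^ m" using x by (intro power_mono) auto
    also have "\<dots> \<le> (x * (x + 1)) ^ m * x ^ (4 * n)" using x by (simp add: one_le_power)
    finally show False using eq by simp
  next
    case 3
    \<comment> \<open>After the sign change, positivity forces 0 < w < 1, so one side is at most 1
      while (w + 1)^m exceeds 1.\<close>
    define w where "w = - x"
    have w: "w > 0" "x = - w" using 3 by (simp_all add: w_def)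
    have "(x * (x + 1)) ^ m = - ((w * (1 - w)) ^ m)" "(x - 1) ^ m = - ((w + 1) ^ m)" "x ^ (4 * n) = w ^ (4 * n)"
    proof -
      have "x * (x + 1) = - (w * (1 - w))" "x - 1 = - (w + 1)" unfolding w(2) by (simp_all add: algebra_simps)
      then show "(x * (x + 1)) ^ m = - ((w * (1 - w)) ^ m)" "(x - 1) ^ m = - ((w + 1) ^ m)"
        by (simp_all only: power_minus_odd[OF odd_m])
      show "x ^ (4 * n) = w ^ (4 * n)" unfolding w(2) by simp
    qed
    then have eq': "(w * (1 - w)) ^ m * w ^ (4 * n) = (w + 1) ^ m" using eq by simp
    then have "(w * (1 - w)) ^ m * w ^ (4 * n) > 0" using w by simp
    then have "(w * (1 - w)) ^ m > 0" using w by (simp add: zero_less_mult_iff)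
    then have "w * (1 - w) > 0" using odd_m m by (simp add: zero_less_power_eq)
    then have w1: "w < 1" using w by (simp add: zero_less_mult_iff)
    have "(w * (1 - w)) ^ m * w ^ (4 * n) \<le> 1 * 1"
      using w w1 by (intro mult_mono power_le_one mult_le_one) auto
    also have "1 * 1 < (w + 1) ^ m" using w m by (simp add: one_less_power)
    finally show False using eq' by simp
  qed
qed

text \<open>Logarithmic differentiation: a multiple root satisfies (m + 4n)(z^2 - 1) = 2mz, which
  has only real solutions, whereas \<open>FW m n\<close> has no real root.\<close>

lemma FW_simple_roots:
  assumes "ceval (FW m n) z = 0"
  shows "ceval (pderiv (FW m n)) z \<noteq> 0"
proof
  assume D: "ceval (pderiv (FW m n)) z = 0"
  define P where "P = (z * (z + 1)) ^ m"
  define R where "R = z ^ (4 * n)"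
  define B where "B = (z - 1) ^ m"
  have PRB: "P * R = B" using assms by (simp add: ceval_FW P_def R_def B_def)
  have pd: "pderiv (FW m n) = smult (of_nat m) (([:0, 1:] * [:1, 1:]) ^ (m - 1)) * [:1, 2:] * [:0, 1:] ^ (4 * n)
      + ([:0, 1:] * [:1, 1:]) ^ m * smult (of_nat (4 * n)) ([:0, 1:] ^ (4 * n - 1))
      - smult (of_nat m) ([:-1, 1:] ^ (m - 1))"
    unfolding FW_def by (simp add: numeral_poly pderiv_mult pderiv_power pderiv_diff pderiv_pCons algebra_simps)
  have lin: "ceval [:0, 1:] z = z" "ceval [:1, 1:] z = z + 1" "ceval [:1, 2:] z = 2 * z + 1" "ceval [:-1, 1:] z = z - 1"
    by simp_all
  \<comment> \<open>The factor z (z + 1)(z - 1) restores the lowered exponents, after which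
    \<open>P * R = B\<close> allows factoring out \<open>B\<close>.\<close>
  have "0 = z * (z + 1) * (z - 1) * ceval (pderiv (FW m n)) z" using D by simp
  also have "\<dots> = of_nat m * ((z * (z + 1)) * (z * (z + 1)) ^ (m - 1)) * (2 * z + 1) * R * (z - 1)
      + P * of_nat (4 * n) * (z * z ^ (4 * n - 1)) * (z + 1) * (z - 1)
      - of_nat m * ((z - 1) * (z - 1) ^ (m - 1)) * z * (z + 1)"
    unfolding pd P_def R_def B_def of_int_poly_hom.hom_mult of_int_poly_hom.hom_add of_int_poly_hom.hom_minus
      of_int_poly_hom.hom_power of_int_hom.map_poly_hom_smult poly_mult poly_add poly_diff poly_power poly_smult lin
    by (simp add: algebra_simps)
  also have "(z * (z + 1)) * (z * (z + 1)) ^ (m - 1) = P" using m by (cases m) (auto simp: P_def)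
  also have "z * z ^ (4 * n - 1) = R" using n by (cases "4 * n") (auto simp: R_def)
  also have "(z - 1) * (z - 1) ^ (m - 1) = B" using m by (cases m) (auto simp: B_def)
  also have "of_nat m * P * (2 * z + 1) * R * (z - 1) + P * of_nat (4 * n) * R * (z + 1) * (z - 1) - of_nat m * B * z * (z + 1)
     = B * (of_nat (m + 4 * n) * (z * z - 1) - 2 * of_nat m * z)"
    unfolding PRB[symmetric] by (simp add: algebra_simps)
  finally have "B * (of_nat (m + 4 * n) * (z * z - 1) - 2 * of_nat m * z) = 0" by simp
  moreover have "B \<noteq> 0"
  proof
    assume "B = 0"
    then have "z = of_real 1" by (simp add: B_def)
    then show False using assms FW_no_real_root[of 1] by simp
  qed
  ultimately have q: "of_nat (m + 4 * n) * (z * z - 1) - 2 * of_nat m * z = 0" by simp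
  define N where "N = real (m + 4 * n)"
  have N: "N > 0" using m by (simp add: N_def)
  have re: "N * (Re z * Re z - Im z * Im z - 1) - 2 * real m * Re z = 0"
    using arg_cong[OF q, of Re] by (simp add: N_def)
  have im: "N * (Re z * Im z + Im z * Re z) - 2 * real m * Im z = 0"
    using arg_cong[OF q, of Im] by (simp add: N_def)
  \<comment> \<open>Otherwise the imaginary part gives N Re z = m, and the real part becomes -N
    (|z|^2 + 1) = 0.\<close>
  have "Im z = 0"
  proof (rule ccontr)
    assume "Im z \<noteq> 0"
    moreover have "2 * Im z * (N * Re z - real m) = 0" using im by (simp add: algebra_simps)
    ultimately have "real m = N * Re z" by simp
    then have "N * (Re z * Re z + Im z * Im z + 1) = 0" using re by (simp add: algebra_simps)
    moreover have "Re z * Re z + Im z * Im z + 1 > 0" by (simp add: add_nonneg_pos)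
    ultimately show False using N by simp
  qed
  then have "z = of_real (Re z)" by (simp add: complex_eq_iff)
  then show False using assms FW_no_real_root[of "Re z"] by simp
qed

section \<open>Transfer of irreducibility from the quadrinomial to \<open>FW m n\<close>\<close>

lemma FW_cofactor_root:
  assumes "ceval FW_cofactor z = 0"
  obtains t where "t ^ m = z" "ceval quad_cofactor t = 0"
proof -
  have F: "ceval (FW m n) z = (z\<^sup>2 + 1) * ceval FW_cofactor z"
    by (simp only: FW_eq of_int_poly_hom.hom_mult poly_mult ceval_X2_plus_1)
  then have F0: "ceval (FW m n) z = 0" using assms by simp
  have "z\<^sup>2 \<noteq> -1"
  proof
    assume z: "z\<^sup>2 = -1"
    have "ceval (pderiv (FW m n)) z = (z\<^sup>2 + 1) * ceval (pderiv FW_cofactor) z + ceval FW_cofactor z * ceval (pderiv [:1, 0, 1:]) z"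
      by (simp only: FW_eq pderiv_mult of_int_poly_hom.hom_mult of_int_poly_hom.hom_add poly_mult poly_add
        ceval_X2_plus_1)
    then show False using FW_simple_roots[OF F0] z assms by simp
  qed
  moreover obtain t where t: "t ^ m = z" "ceval quad t = 0" using FW_root_param[OF F0] .
  \<comment> \<open>If t^2 were -1, then z^2 = (-1)^m = -1, as \<open>m\<close> is odd; simplicity
    of the roots has just excluded this.\<close>
  moreover have "z\<^sup>2 = (t\<^sup>2) ^ m" unfolding t(1)[symmetric] by (simp add: mult.commute flip: power_mult)
  ultimately have "t\<^sup>2 \<noteq> -1" using odd_m by auto
  then have "ceval quad_cofactor t = 0" using t(2) by (simp add: ceval_quad eq_neg_iff_add_eq_0)
  then show ?thesis using that t(1) by blast
qed

lemma ceval_pcompose: "ceval (p \<circ>\<^sub>p q) z = ceval p (ceval q z)"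
  by (induction p) (simp_all add: pcompose_pCons of_int_hom.map_poly_pCons_hom of_int_poly_hom.hom_add of_int_poly_hom.hom_mult)

text \<open>With X = t^m and N = m + 4n the quadrinomial is a - b for a = t^N (X + 1) and b = X - 1,
  while \<open>FW m n\<close> at X is a^m - b^m.\<close>

lemma quad_cofactor_dvd_FW_pcompose: "quad_cofactor dvd FW m n \<circ>\<^sub>p monom 1 m"
proof -
  define X :: "int poly" where "X = monom 1 m"
  have "monom 1 (m + 4 * n) * (X + 1) - (X - 1) dvd (monom 1 (m + 4 * n) * (X + 1)) ^ m - (X - 1) ^ m"
    by (rule diff_dvd_power_diff)
  also have "monom 1 (m + 4 * n) * (X + 1) - (X - 1) = quad"
    unfolding quad_def quadrinomial_def X_def by (simp add: algebra_simps mult_monom)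
  also have "monom 1 (m + 4 * n) * (X + 1) = (X * (X + 1)) * monom 1 (4 * n)"
    unfolding X_def by (simp add: algebra_simps mult_monom)
  also have "((X * (X + 1)) * monom 1 (4 * n)) ^ m - (X - 1) ^ m = FW m n \<circ>\<^sub>p X"
    unfolding FW_altdef
    by (simp add: pcompose_diff pcompose_mult pcompose_add pcompose_1 pcompose_hom.hom_power pcompose_pCons
      power_mult_distrib) (simp add: X_def monom_power mult_ac)
  finally have "quad dvd FW m n \<circ>\<^sub>p X" .
  then show ?thesis unfolding X_def quad_eq by (rule dvd_mult_right)
qed

text \<open>Every root of \<open>v\<close> is t^m for a root t of \<open>quad_cofactor\<close>,
  hence by \<open>dvd\<close> also a root of \<open>u\<close>, and so would be a multiple root of
  \<open>FW m n\<close>.\<close>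

lemma FW_cofactor_factor_const:
  assumes uv: "FW_cofactor = u * v" and dvd: "quad_cofactor dvd u \<circ>\<^sub>p monom 1 m"
  shows "degree v = 0"
proof (rule ccontr)
  assume "degree v \<noteq> 0"
  then obtain z where z: "ceval v z = 0" using ceval_root_exists[of v] by auto
  then have "ceval FW_cofactor z = 0" unfolding uv by (simp add: of_int_poly_hom.hom_mult)
  then obtain t where t: "t ^ m = z" "ceval quad_cofactor t = 0" by (rule FW_cofactor_root)
  obtain r where r: "u \<circ>\<^sub>p monom 1 m = quad_cofactor * r" using dvd by (elim dvdE)
  have "ceval u z = ceval (u \<circ>\<^sub>p monom 1 m) t" by (simp add: ceval_pcompose poly_monom t)
  also have "\<dots> = 0" unfolding r by (simp add: of_int_poly_hom.hom_mult t)
  finally have u: "ceval u z = 0" .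
  have F: "FW m n = ([:1, 0, 1:] * u) * v" unfolding FW_eq uv by (simp only: mult.assoc)
  have "ceval (FW m n) z = 0" by (simp only: F of_int_poly_hom.hom_mult poly_mult z mult_zero_right)
  moreover have "ceval (pderiv (FW m n)) z = 0"
    by (simp only: F pderiv_mult of_int_poly_hom.hom_mult of_int_poly_hom.hom_add poly_mult poly_add z u
       mult_zero_right mult_zero_left add_0)
  ultimately show False using FW_simple_roots by blast
qed

text \<open>Degrees decide: 4n + 2m - 2 exceeds 2m.\<close>

lemma quad_cofactor_not_dvd: "\<not> quad_cofactor dvd [:1, 0, 1:] \<circ>\<^sub>p monom 1 m"
proof
  assume dvd: "quad_cofactor dvd [:1, 0, 1:] \<circ>\<^sub>p monom 1 m"
  have "[:1, 0, 1:] \<circ>\<^sub>p monom 1 m = monom 1 (2 * m) + (1 :: int poly)"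
    by (simp add: pcompose_pCons mult_monom mult_2)
  with dvd have "quad_cofactor dvd monom 1 (2 * m) + 1" by (simp only:)
  moreover have d: "degree (monom 1 (2 * m) + (1 :: int poly)) = 2 * m"
    using m by (subst degree_add_eq_left) (auto simp: degree_monom_eq)
  moreover from d have "monom 1 (2 * m) + (1 :: int poly) \<noteq> 0" using m by auto
  ultimately have "degree quad_cofactor \<le> 2 * m"
    by (metis dvd_imp_degree_le)
  then show False using degree_quad_cofactor n by simp
qed

text \<open>After substituting t^m, the prime \<open>quad_cofactor\<close> divides the product of
  t^(2m) + 1 and the images of \<open>u\<close> and \<open>v\<close>. It must divide one of these
  images, and then the other factor is constant.\<close>

lemma FW_cofactor_factors:
  assumes uv: "FW_cofactor = u * v"
  shows "degree u = 0 \<or> degree v = 0"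
proof -
  have "quad_cofactor dvd ([:1, 0, 1:] \<circ>\<^sub>p monom 1 m) * ((u \<circ>\<^sub>p monom 1 m) * (v \<circ>\<^sub>p monom 1 m))"
    using quad_cofactor_dvd_FW_pcompose unfolding FW_eq uv by (simp only: pcompose_mult)
  then have "quad_cofactor dvd u \<circ>\<^sub>p monom 1 m \<or> quad_cofactor dvd v \<circ>\<^sub>p monom 1 m"
    using prime_quad_cofactor quad_cofactor_not_dvd by (auto simp only: prime_elem_dvd_mult_iff)
  then show ?thesis
    using FW_cofactor_factor_const[OF uv] FW_cofactor_factor_const[of v u] uv by (auto simp: mult.commute)
qed

lemma irreducible_FW_cofactor: "irreducible (map_poly rat_of_int FW_cofactor)"
proof -
  have "degree FW_cofactor > 0"
  proof (rule ccontr)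
    assume "\<not> degree FW_cofactor > 0"
    then have dH: "degree FW_cofactor = 0" by simp
    \<comment> \<open>A constant is unchanged by the substitution, so \<open>quad_cofactor\<close>,
      of positive degree, would divide a nonzero constant.\<close>
    have "quad_cofactor dvd ([:1, 0, 1:] \<circ>\<^sub>p monom 1 m) * (FW_cofactor \<circ>\<^sub>p monom 1 m)"
      using quad_cofactor_dvd_FW_pcompose unfolding FW_eq by (simp only: pcompose_mult)
    then have "quad_cofactor dvd FW_cofactor \<circ>\<^sub>p monom 1 m"
      using prime_quad_cofactor quad_cofactor_not_dvd by (auto simp only: prime_elem_dvd_mult_iff)
    also have "FW_cofactor \<circ>\<^sub>p monom 1 m = FW_cofactor" using dH by (auto elim!: degree_eq_zeroE)
    finally have "quad_cofactor dvd FW_cofactor" .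
    moreover have "FW_cofactor \<noteq> 0" using FW_no_real_root[of 1] unfolding FW_eq by auto
    ultimately have "degree quad_cofactor = 0" using dH dvd_imp_degree_le[of quad_cofactor FW_cofactor] by simp
    then show False using degree_quad_cofactor n by simp
  qed
  then have "irreducible\<^sub>d FW_cofactor"
    by (rule irreducible\<^sub>dI) (fastforce dest: FW_cofactor_factors)
  \<comment> \<open>Gauss's lemma: \<open>irreducible\<^sub>d\<close> concerns only factors of
    smaller positive degree, which over the rationals is irreducibility.\<close>
  then show ?thesis using irreducible\<^sub>d_int_rat by simp
qed

end

theorem theorem1p1:
  fixes m :: nat
  assumes "m > 0" and "odd m"
  shows "\<exists>N::nat. \<forall>n::nat. n \<ge> 1 \<longrightarrow> n \<ge> N \<longrightarrow> gcd n m = 1 \<longrightarrow>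
           (\<exists>g :: int poly. FW m n = [:1, 0, 1:] * g \<and>
              irreducible (map_poly (of_int :: int \<Rightarrow> rat) g))"
proof (intro exI allI impI conjI)
  fix n :: nat
  assume "n \<ge> 1" "gcd n m = 1"
  then have *: "odd m" "0 < n" "gcd n m = 1" using assms by auto
  show "FW m n = [:1, 0, 1:] * FW_cofactor m n" by (rule FW_eq[OF *])
  show "irreducible (map_poly (of_int :: int \<Rightarrow> rat) (FW_cofactor m n))" by (rule irreducible_FW_cofactor[OF *])
qed

end
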